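(* Let $n\in\mathbb{N}$ (a positive integer) and let $F=F_n$ be the $n\times n$ matrix with entries $f_{ij}=\omega^{(i-1)(j-1)}$, where $\omega=\cos(2\pi/n)-\mathsf{i}\sin(2\pi/n)$. Then $F$ is ideal, extremal, and $\dim\mathcal{C}(F)=n$.
   Context: A matrix $A\geqslant 0$ (nonnegative) has real nonnegative entries. An $n\times n$ matrix with $n\geqslant 2$ is reducible if it is permutation-similar to a block upper triangular matrix with two nonempty square diagonal blocks; a square matrix that is not reducible is irreducible. An invertible complex matrix $S$ is a Perron similarity if $SDS^{-1}$ is irreducible and nonnegative for some diagonal matrix $D$. For $x\in\mathbb{C}^n$, $D_x$ is the diagonal matrix with diagonal $x$, $M_x:=SD_xS^{-1}$, and $e$ is the all-ones vector. Put $\mathcal{C}(S):=\{x\in\mathbb{C}^n\mid M_x\geqslant0\}$ and $\mathcal{P}(S):=\{x\in\mathcal{C}(S)\mid M_xe=e\}$. The row cone $\mathcal{C}_r(S)$ is the set of all linear combinations with nonnegative real coefficients of the rows of $S$ (viewed as column vectors). A Perron similarity $S$ is ideal if $\mathcal{C}(S)=\mathcal{C}_r(S)$. The dimension of a convex cone $K$ is the dimension of the real vector space $K+(-K)$. A stochastic matrix is a nonnegative matrix all of whose row sums equal $1$. Let $\mathbb{SL}_1^n$ be the set of $x\in\mathbb{C}^n$ with $x_1=1$ such that the multiset $\{x_1,\dots,x_n\}$ is the spectrum of some $n\times n$ stochastic matrix, and let $\pi_1:\mathbb{C}^n\to\mathbb{C}^{n-1}$ delete the first coordinate. A point $x\in\mathbb{SL}_1^n$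 is extremal if $\alpha\,\pi_1(x)\notin\pi_1(\mathbb{SL}_1^n)$ for all $\alpha>1$. A Perron similarity $S$ is extremal if $\mathcal{P}(S)$ contains an extremal point of $\mathbb{SL}_1^n$ other than $e$.
   Formalization: The claim that F is extremal is made only for n ≥ 2, because for n = 1 the only point of SL_1^1 is e, so F_1 cannot be extremal; F ideal and dim C(F) = n are still claimed for all n ≥ 1. *)

theory Defs
  imports
    "Jordan_Normal_Form.Gauss_Jordan_Elimination"
    "Jordan_Normal_Form.Char_Poly"
    "Jordan_Normal_Form.VS_Connect"
    "HOL-Library.Nonpos_Ints"
begin

text \<open>
  Rows, columns and coordinates are numbered from 0. Real matrices are taken as complex
  matrices whose entries are real, since they arise as products of complex ones.
\<close>

definition nonneg_mat :: "complex mat \<Rightarrow> bool" where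
  "nonneg_mat A \<longleftrightarrow> (\<forall>i < dim_row A. \<forall>j < dim_col A. A $$ (i, j) \<in> \<real>\<^sub>\<ge>\<^sub>0)"

definition permutation_mat :: "nat \<Rightarrow> complex mat \<Rightarrow> bool" where
  "permutation_mat n P \<longleftrightarrow>
     (\<exists>p. p permutes {..<n} \<and> P = mat n n (\<lambda>(i, j). if p i = j then 1 else 0))"

text \<open>
  The condition \<open>0 < k < n\<close> expresses that both diagonal blocks are nonempty; it excludes
  \<open>n < 2\<close>, so every \<open>1 \<times> 1\<close> matrix is irreducible, the zero matrix included.
\<close>

definition reducible_mat :: "complex mat \<Rightarrow> bool" where
  "reducible_mat A \<longleftrightarrow>
     (let n = dim_row A in
        A \<in> carrier_mat n n \<and>
        (\<exists>P Q k B C D. permutation_mat n P \<and> 0 < k \<and> k < n \<and>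
           B \<in> carrier_mat k k \<and> C \<in> carrier_mat k (n - k) \<and> D \<in> carrier_mat (n - k) (n - k) \<and>
           similar_mat_wit A (four_block_mat B C (0\<^sub>m (n - k) k) D) P Q))"

definition irreducible_mat :: "complex mat \<Rightarrow> bool" where
  "irreducible_mat A \<longleftrightarrow> square_mat A \<and> \<not> reducible_mat A"

text \<open>Only used for invertible \<open>S\<close>, where \<open>mat_inverse S\<close> is not \<open>None\<close>.\<close>

definition inv_mat :: "complex mat \<Rightarrow> complex mat" where
  "inv_mat S = the (mat_inverse S)"

definition perron_similarity :: "complex mat \<Rightarrow> bool" where
  "perron_similarity S \<longleftrightarrow>
     invertible_mat S \<and>
     (\<exists>D \<in> carrier_mat (dim_row S) (dim_row S). diagonal_mat D \<and>
        irreducible_mat (S * D * inv_mat S) \<and> nonneg_mat (S * D * inv_mat S))"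

definition M_mat :: "complex mat \<Rightarrow> complex vec \<Rightarrow> complex mat" where
  "M_mat S x = S * mat_diag (dim_row S) (\<lambda>i. x $ i) * inv_mat S"

definition ones_vec :: "nat \<Rightarrow> complex vec" where
  "ones_vec n = vec n (\<lambda>_. 1)"

definition spectracone :: "complex mat \<Rightarrow> complex vec set" where
  "spectracone S = {x \<in> carrier_vec (dim_row S). nonneg_mat (M_mat S x)}"

definition spectratope :: "complex mat \<Rightarrow> complex vec set" where
  "spectratope S =
     {x \<in> spectracone S. M_mat S x *\<^sub>v ones_vec (dim_row S) = ones_vec (dim_row S)}"

definition row_cone :: "complex mat \<Rightarrow> complex vec set" where
  "row_cone S =
     {finsum_vec TYPE(complex) (dim_col S) (\<lambda>i. complex_of_real (c i) \<cdot>\<^sub>v row S i) {..<dim_row S}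
      | c :: nat \<Rightarrow> real. \<forall>i < dim_row S. 0 \<le> c i}"

definition ideal_perron :: "complex mat \<Rightarrow> bool" where
  "ideal_perron S \<longleftrightarrow> perron_similarity S \<and> spectracone S = row_cone S"

text \<open>
  The real vector space \<open>K + (-K)\<close>: complex vectors with scalars restricted to the reals.
  The components \<open>mult\<close> and \<open>one\<close> of the module record play no role.
\<close>

definition cone_space :: "nat \<Rightarrow> complex vec set \<Rightarrow> (real, complex vec) module" where
  "cone_space n K = \<lparr>
     carrier = {x - y | x y. x \<in> K \<and> y \<in> K},
     mult = undefined,
     one = undefined,
     zero = 0\<^sub>v n,
     add = (+),
     smult = (\<lambda>a v. complex_of_real a \<cdot>\<^sub>v v)\<rparr>"

definition cone_dim :: "nat \<Rightarrow> complex vec set \<Rightarrow> nat" where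
  "cone_dim n K = vectorspace.dim class_ring (cone_space n K)"

definition stochastic_mat :: "nat \<Rightarrow> complex mat \<Rightarrow> bool" where
  "stochastic_mat n A \<longleftrightarrow>
     A \<in> carrier_mat n n \<and> nonneg_mat A \<and> (\<forall>i < n. (\<Sum>j < n. A $$ (i, j)) = 1)"

text \<open>The spectrum is counted with algebraic multiplicity.\<close>

definition SL1 :: "nat \<Rightarrow> complex vec set" where
  "SL1 n = {x \<in> carrier_vec n. x $ 0 = 1 \<and>
     (\<exists>A. stochastic_mat n A \<and> mset (list_of_vec x) = proots (char_poly A))}"

definition proj1 :: "complex vec \<Rightarrow> complex vec" where
  "proj1 x = vec (dim_vec x - 1) (\<lambda>i. x $ Suc i)"

definition extremal_point :: "nat \<Rightarrow> complex vec \<Rightarrow> bool" where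
  "extremal_point n x \<longleftrightarrow>
     x \<in> SL1 n \<and> (\<forall>\<alpha>::real. 1 < \<alpha> \<longrightarrow> complex_of_real \<alpha> \<cdot>\<^sub>v proj1 x \<notin> proj1 ` SL1 n)"

definition extremal_perron :: "complex mat \<Rightarrow> bool" where
  "extremal_perron S \<longleftrightarrow>
     perron_similarity S \<and>
     (\<exists>x \<in> spectratope S. extremal_point (dim_row S) x \<and> x \<noteq> ones_vec (dim_row S))"

definition dft_mat :: "nat \<Rightarrow> complex mat" where
  "dft_mat n =
     (let \<omega> = complex_of_real (cos (2 * pi / real n)) - \<i> * complex_of_real (sin (2 * pi / real n))
      in mat n n (\<lambda>(i, j). \<omega> ^ (i * j)))"

end

theory Submission
  imports Defs
begin

text \<open>
  Conjugation by the Fourier matrix \<open>F\<close> turns diagonal matrices into circulant ones, because its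
  columns are the common eigenvectors of all circulant matrices. The right coordinates on the
  diagonal are the Fourier coefficients: every vector \<open>x\<close> is \<open>F a\<close> for a unique \<open>a\<close>, and the entry
  \<open>(i, j)\<close> of \<open>F D\<^sub>x F\<inverse>\<close> is then the coordinate of \<open>a\<close> at \<open>j - i\<close> modulo \<open>n\<close>
  (\<open>M_mat_dft_circulant\<close>). So \<open>a\<close> is the first row of a circulant matrix, and the claims become
  statements about \<open>a\<close>.

  The matrix is nonnegative iff \<open>a\<close> is, hence the spectracone is the set of all \<open>F a\<close> with
  \<open>a \<ge> 0\<close> (\<open>spectracone_dft\<close>). As \<open>F\<close> is symmetric, these are the nonnegative combinations of its
  rows, which is idealness once \<open>F\<close> is known to be a Perron similarity; for the latter, \<open>a = e\<close> gives
  the all-ones matrix, which is irreducible because conjugating it by a permutation cannot create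
  a zero entry (\<open>irreducible_if_no_zero_entry\<close>). Since \<open>F\<close> is invertible, the cone is the injective
  real-linear image of the nonnegative orthant, so it has dimension \<open>n\<close> (\<open>cone_dim_simplicial\<close>).

  For extremality, the unit vector \<open>a\<close> at position 1 gives the cyclic permutation matrix, whose
  spectrum \<open>x\<close> consists of the \<open>n\<close>-th roots of unity. Eigenvalues of stochastic matrices have
  modulus at most 1, so no spectrum can have a coordinate \<open>\<alpha> x\<^sub>k\<close> with \<open>\<alpha> > 1\<close> and \<open>x\<^sub>k\<close> on the unit
  circle (\<open>extremal_pointI\<close>).
\<close>

section \<open>Diagonal matrices conjugated by an invertible matrix\<close>

lemma inv_mat_eqI:
  assumes S: "S \<in> carrier_mat n n" and G: "G \<in> carrier_mat n n"
    and SG: "S * G = 1\<^sub>m n" and GS: "G * S = 1\<^sub>m n"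
  shows "inv_mat S = G"
proof (cases "mat_inverse S")
  case None
  have "S \<in> Units (ring_mat TYPE(complex) n undefined)"
    using S G SG GS by (auto simp: Units_def ring_mat_def)
  with mat_inverse(1)[OF S None, of undefined] show ?thesis by auto
next
  case (Some B)
  with mat_inverse(2)[OF S Some] have B: "B * S = 1\<^sub>m n" "B \<in> carrier_mat n n" by auto
  have "B = B * (S * G)" using B SG by simp
  also have "\<dots> = B * S * G" using B(2) S G by (simp add: assoc_mult_mat)
  also have "\<dots> = G" using B G by simp
  finally show ?thesis using Some by (simp add: inv_mat_def)
qed

lemma M_mat_index:
  assumes S: "S \<in> carrier_mat n n" and G: "inv_mat S \<in> carrier_mat n n"
    and "i < n" "j < n"
  shows "M_mat S x $$ (i, j) = (\<Sum>k<n. S $$ (i, k) * x $ k * inv_mat S $$ (k, j))"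
  using assms unfolding M_mat_def
  by (simp add: mat_diag_mult_right[OF S] scalar_prod_def atLeast0LessThan)

lemma M_mat_similar:
  assumes S: "S \<in> carrier_mat n n" and G: "G \<in> carrier_mat n n"
    and SG: "S * G = 1\<^sub>m n" and GS: "G * S = 1\<^sub>m n"
  shows "similar_mat (M_mat S x) (mat_diag n (\<lambda>i. x $ i))"
  unfolding similar_mat_def similar_mat_wit_def M_mat_def inv_mat_eqI[OF assms] Let_def
  using assms by (intro exI[of _ S] exI[of _ G]) auto

lemma proots_char_poly_mat_diag:
  assumes "dim_vec (x :: complex vec) = n"
  shows "proots (char_poly (mat_diag n (\<lambda>i. x $ i))) = mset (list_of_vec x)"
proof -
  let ?D = "mat_diag n (\<lambda>i. x $ i)"
  have D: "?D \<in> carrier_mat n n" by simp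
  have ut: "upper_triangular ?D" by (auto simp: upper_triangular_def mat_diag_def)
  have diag: "diag_mat ?D = list_of_vec x"
    using assms by (auto simp: diag_mat_def mat_diag_def list_of_vec_index intro!: nth_equalityI)
  have "proots (\<Prod>a\<leftarrow>xs. [:- a, 1:]) = mset xs" for xs :: "complex list"
  proof (induction xs)
    case (Cons a xs)
    have "(\<Prod>a\<leftarrow>xs. [:- a, 1:]) \<noteq> 0" by (auto simp: prod_list_zero_iff)
    moreover have "[:- a, 1:] \<noteq> 0" by simp
    ultimately show ?case
      using Cons proots_mult[of "[:- a, 1:]" "\<Prod>a\<leftarrow>xs. [:- a, 1:]"]
      by (simp del: mult_pCons_left)
  qed simp
  then show ?thesis unfolding char_poly_upper_triangular[OF D ut] diag .
qed

section \<open>Irreducibility of matrices without zero entries\<close>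

text \<open>
  A permutation similarity only moves entries around, so none of the conjugates of \<open>A\<close> can have
  the zero block that reducibility demands.
\<close>

lemma irreducible_if_no_zero_entry:
  assumes A: "A \<in> carrier_mat n n"
    and nz: "\<And>i j. i < n \<Longrightarrow> j < n \<Longrightarrow> A $$ (i, j) \<noteq> 0"
  shows "irreducible_mat A"
proof -
  have False if P: "permutation_mat n P" and k: "0 < k" "k < n"
    and B: "B \<in> carrier_mat k k" and C: "C \<in> carrier_mat k (n - k)"
    and D: "D \<in> carrier_mat (n - k) (n - k)"
    and sim: "similar_mat_wit A (four_block_mat B C (0\<^sub>m (n - k) k) D) P Q" for P Q k B C D
  proof -
    let ?E = "four_block_mat B C (0\<^sub>m (n - k) k) D"
    obtain p where p: "p permutes {..<n}"
      and Pdef: "P = mat n n (\<lambda>(i, j). if p i = j then 1 else 0)"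
      using P unfolding permutation_mat_def by auto
    have car: "?E \<in> carrier_mat n n" "Q \<in> carrier_mat n n" "P \<in> carrier_mat n n"
      and QP: "Q * P = 1\<^sub>m n" and AE: "A = P * ?E * Q"
      using sim A unfolding similar_mat_wit_def Let_def by auto
    \<comment> \<open>The form \<open>A P = P E\<close> avoids describing the inverse \<open>Q\<close> as a permutation matrix. In
      row \<open>i\<close> and column 0, each side reduces to one summand: an entry of \<open>A\<close> on the left, and on
      the right, as \<open>i\<close> is chosen with \<open>p i = k\<close>, the corner entry of the zero block.\<close>
    have "A * P = P * ?E * (Q * P)"
      unfolding AE using car by (simp add: assoc_mult_mat[of _ n n _ n _ n])
    then have AP: "A * P = P * ?E" using car QP by (metis mult_carrier_mat right_mult_one_mat)
    obtain i where i: "i < n" "p i = k"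
      using permutes_surj[OF p] k p permutes_in_image[OF p] by (metis lessThan_iff surjD)
    obtain l where l: "l < n" "p l = 0"
      using permutes_surj[OF p] k p permutes_in_image[OF p]
      by (metis lessThan_iff surjD order.strict_trans)
    have "(A * P) $$ (i, 0) = (\<Sum>j<n. if j = l then A $$ (i, j) else 0)"
    proof -
      have pl: "p j = 0 \<longleftrightarrow> j = l" for j
        using injD[OF permutes_inj[OF p], of j l] l(2) by auto
      have "(A * P) $$ (i, 0) = (\<Sum>j<n. A $$ (i, j) * (if p j = 0 then 1 else 0))"
        using A i k by (simp add: Pdef scalar_prod_def atLeast0LessThan)
      also have "\<dots> = (\<Sum>j<n. if j = l then A $$ (i, j) else 0)"
        by (intro sum.cong refl) (simp add: pl)
      finally show ?thesis .
    qed
    also have "\<dots> = A $$ (i, l)" using l by simp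
    finally have "(A * P) $$ (i, 0) \<noteq> 0" using nz[OF i(1) l(1)] by simp
    moreover have "(P * ?E) $$ (i, 0) = (\<Sum>j<n. if j = k then ?E $$ (j, 0) else 0)"
    proof -
      have "(P * ?E) $$ (i, 0) = (\<Sum>j<n. (if p i = j then 1 else 0) * ?E $$ (j, 0))"
        using car i k B D by (simp add: Pdef scalar_prod_def atLeast0LessThan del: index_mat_four_block)
      also have "\<dots> = (\<Sum>j<n. if j = k then ?E $$ (j, 0) else 0)"
        by (intro sum.cong refl) (auto simp: i(2))
      finally show ?thesis .
    qed
    moreover have "?E $$ (k, 0) = 0" using B D k by simp
    ultimately show False using AP k by simp
  qed
  then show ?thesis using A unfolding irreducible_mat_def reducible_mat_def Let_def by auto
qed

section \<open>Spectra of stochastic matrices and extremal points\<close>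

text \<open>
  At a coordinate where an eigenvector \<open>v\<close> is largest in modulus, \<open>l v\<^sub>i\<close> is a convex combination
  of the coordinates of \<open>v\<close>, so its modulus does not exceed that of \<open>v\<^sub>i\<close>.
\<close>

lemma stochastic_eigenvalue_norm_le_1:
  assumes st: "stochastic_mat n A" and ev: "eigenvalue A l"
  shows "norm l \<le> 1"
proof -
  have A: "A \<in> carrier_mat n n" and nn: "nonneg_mat A"
    and rs: "\<And>i. i < n \<Longrightarrow> (\<Sum>j<n. A $$ (i, j)) = 1"
    using st unfolding stochastic_mat_def by auto
  obtain v where v: "v \<in> carrier_vec n" "v \<noteq> 0\<^sub>v n" "A *\<^sub>v v = l \<cdot>\<^sub>v v"
    using ev A unfolding eigenvalue_def eigenvector_def by auto
  then obtain i0 where i0: "i0 < n" "v $ i0 \<noteq> 0" by (metis carrier_vecD eq_vecI index_zero_vec)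
  have "Max ((\<lambda>i. norm (v $ i)) ` {..<n}) \<in> (\<lambda>i. norm (v $ i)) ` {..<n}"
    using i0(1) by (intro Max_in) auto
  then obtain i where i: "i < n" "Max ((\<lambda>i. norm (v $ i)) ` {..<n}) = norm (v $ i)" by auto
  have max: "norm (v $ j) \<le> norm (v $ i)" if "j < n" for j
    using that unfolding i(2)[symmetric] by simp
  have pos: "norm (v $ i) > 0" using max[OF i0(1)] i0(2) by (metis less_le_trans zero_less_norm_iff)
  have nrm: "complex_of_real (norm (A $$ (i, j))) = A $$ (i, j)" if "j < n" for j
  proof -
    have "A $$ (i, j) \<in> \<real>\<^sub>\<ge>\<^sub>0" using nn A i(1) that unfolding nonneg_mat_def by auto
    then show ?thesis by (auto elim!: nonneg_Reals_cases)
  qed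
  have "complex_of_real (\<Sum>j<n. norm (A $$ (i, j))) = 1"
    using rs[OF i(1)] nrm by simp
  then have sum1: "(\<Sum>j<n. norm (A $$ (i, j))) = 1" using of_real_eq_1_iff by blast
  have "l * v $ i = (\<Sum>j<n. A $$ (i, j) * v $ j)"
    using arg_cong[OF v(3), of "\<lambda>w. w $ i"] A v(1) i(1)
    by (simp add: scalar_prod_def atLeast0LessThan)
  then have "norm l * norm (v $ i) \<le> (\<Sum>j<n. norm (A $$ (i, j)) * norm (v $ j))"
    by (metis (no_types, lifting) norm_mult norm_sum sum.cong)
  also have "\<dots> \<le> (\<Sum>j<n. norm (A $$ (i, j)) * norm (v $ i))"
    by (intro sum_mono mult_left_mono max) auto
  also have "\<dots> = norm (v $ i)" by (simp add: sum_distrib_right[symmetric] sum1)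
  finally show ?thesis using pos by simp
qed

lemma SL1_norm_le_1:
  assumes x: "x \<in> SL1 n" and k: "k < n"
  shows "norm (x $ k) \<le> 1"
proof -
  obtain A where st: "stochastic_mat n A" and sp: "mset (list_of_vec x) = proots (char_poly A)"
    and xn: "x \<in> carrier_vec n"
    using x unfolding SL1_def by auto
  have A: "A \<in> carrier_mat n n" using st unfolding stochastic_mat_def by auto
  have "x $ k \<in> set (list_of_vec x)"
    using xn k by (auto simp: set_list_of_vec vec_set_def)
  then have "x $ k \<in># proots (char_poly A)" unfolding sp[symmetric] by simp
  then have "poly (char_poly A) (x $ k) = 0"
    using degree_monic_char_poly[OF A] by (cases "char_poly A = 0") auto
  then show ?thesis
    using stochastic_eigenvalue_norm_le_1[OF st] eigenvalue_root_char_poly[OF A] by blast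
qed

text \<open>
  Scaling by \<open>\<alpha> > 1\<close> would push the coordinate \<open>k\<close> out of the closed unit disc, which contains the
  spectrum of every stochastic matrix. Since \<open>k \<noteq> 0\<close>, this coordinate survives the projection.
\<close>

lemma extremal_pointI:
  assumes x: "x \<in> SL1 n" and k: "0 < k" "k < n" and nk: "norm (x $ k) = 1"
  shows "extremal_point n x"
proof -
  have False if \<alpha>: "1 < \<alpha>" and y: "y \<in> SL1 n" and eq: "complex_of_real \<alpha> \<cdot>\<^sub>v proj1 x = proj1 y"
    for \<alpha> y
  proof -
    have dims: "dim_vec x = n" "dim_vec y = n" using x y unfolding SL1_def by auto
    have "(complex_of_real \<alpha> \<cdot>\<^sub>v proj1 x) $ (k - 1) = proj1 y $ (k - 1)" using eq by simp
    then have "complex_of_real \<alpha> * x $ k = y $ k" using k dims by (cases k) (simp_all add: proj1_def)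
    then have "norm (y $ k) = \<alpha>" using nk \<alpha>
      by (simp add: norm_mult flip: \<open>complex_of_real \<alpha> * x $ k = y $ k\<close>)
    then show False using SL1_norm_le_1[OF y k(2)] \<alpha> by simp
  qed
  then show ?thesis using x unfolding extremal_point_def by (auto simp: image_iff)
qed

lemma spectratope_stochastic:
  assumes S: "S \<in> carrier_mat n n" and G: "inv_mat S \<in> carrier_mat n n" and x: "x \<in> spectratope S"
  shows "stochastic_mat n (M_mat S x)"
proof -
  have M: "M_mat S x \<in> carrier_mat n n" using S G unfolding M_mat_def by auto
  have "(\<Sum>j<n. M_mat S x $$ (i, j)) = 1" if "i < n" for i
  proof -
    have "(M_mat S x *\<^sub>v ones_vec n) $ i = 1"
      using x S that by (simp add: spectratope_def ones_vec_def)
    then show ?thesis using M that by (simp add: scalar_prod_def ones_vec_def atLeast0LessThan)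
  qed
  then show ?thesis using M x by (simp add: stochastic_mat_def spectratope_def spectracone_def)
qed

text \<open>The stochastic matrix that realises \<open>x\<close> as its spectrum is \<open>M\<^sub>x\<close> itself.\<close>

lemma spectratope_imp_SL1:
  assumes S: "S \<in> carrier_mat n n" and G: "G \<in> carrier_mat n n"
    and SG: "S * G = 1\<^sub>m n" and GS: "G * S = 1\<^sub>m n"
    and x: "x \<in> spectratope S" and x0: "x $ 0 = 1"
  shows "x \<in> SL1 n"
proof -
  have xn: "x \<in> carrier_vec n" using x S by (simp add: spectratope_def spectracone_def)
  have "proots (char_poly (M_mat S x)) = mset (list_of_vec x)"
    using char_poly_similar[OF M_mat_similar[OF S G SG GS]] proots_char_poly_mat_diag[of x n] xn by simp
  moreover have "stochastic_mat n (M_mat S x)"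
    using spectratope_stochastic[OF S _ x] inv_mat_eqI[OF S G SG GS] G by simp
  ultimately show ?thesis using xn x0 unfolding SL1_def by auto
qed

section \<open>Cones spanned by the rows of a matrix\<close>

lemma row_cone_eq:
  assumes S: "S \<in> carrier_mat n n"
  shows "row_cone S = {S\<^sup>T *\<^sub>v map_vec complex_of_real c | c. c \<in> carrier_vec n \<and> (\<forall>i<n. 0 \<le> c $ i)}"
    (is "_ = ?R")
proof -
  have comb: "finsum_vec TYPE(complex) n (\<lambda>i. complex_of_real (c i) \<cdot>\<^sub>v row S i) {..<n}
      = S\<^sup>T *\<^sub>v map_vec complex_of_real (vec n c)" for c
  proof -
    have "(\<lambda>i. complex_of_real (c i) \<cdot>\<^sub>v row S i) \<in> {..<n} \<rightarrow> carrier_vec n" using S by auto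
    then show ?thesis using S
      by (intro eq_vecI)
         (auto simp: index_finsum_vec finsum_vec_closed[THEN carrier_vecD] scalar_prod_def
           atLeast0LessThan mult.commute intro!: sum.cong)
  qed
  show ?thesis
  proof (intro equalityI subsetI)
    fix x assume "x \<in> row_cone S"
    then obtain c where "\<forall>i<n. 0 \<le> c i" "x = S\<^sup>T *\<^sub>v map_vec complex_of_real (vec n c)"
      using S comb unfolding row_cone_def by auto
    then show "x \<in> ?R" by (auto intro!: exI[of _ "vec n c"])
  next
    fix x assume "x \<in> ?R"
    then obtain c where c: "c \<in> carrier_vec n" "\<forall>i<n. 0 \<le> c $ i"
      and x: "x = S\<^sup>T *\<^sub>v map_vec complex_of_real c" by auto
    have "vec n (($) c) = c" using c by auto
    then show "x \<in> row_cone S"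
      using S comb[of "($) c"] c x unfolding row_cone_def by (auto intro!: exI[of _ "($) c"])
  qed
qed

text \<open>
  The map \<open>c \<mapsto> A c\<close> is real-linear and injective on real vectors. Its image is exactly
  \<open>K + (-K)\<close>, because a real vector is the difference of its positive and negative parts.
  Hence this map is an isomorphism from \<open>\<real>\<^sup>n\<close> to the space whose dimension is wanted.
\<close>

lemma cone_dim_simplicial:
  assumes A: "A \<in> carrier_mat n n" and B: "B \<in> carrier_mat n n" and BA: "B * A = 1\<^sub>m n"
  shows "cone_dim n {A *\<^sub>v map_vec complex_of_real c | c. c \<in> carrier_vec n \<and> (\<forall>i<n. 0 \<le> c $ i)} = n"
proof -
  define K where "K = {A *\<^sub>v map_vec complex_of_real c | c. c \<in> carrier_vec n \<and> (\<forall>i<n. 0 \<le> c $ i)}"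
  define T where "T c = A *\<^sub>v map_vec complex_of_real c" for c
  let ?V = "module_vec TYPE(real) n" and ?W = "cone_space n K"
  have T_car: "T c \<in> carrier_vec n" if "c \<in> carrier_vec n" for c
    using A that by (simp add: T_def)
  have T_add: "T (c + d) = T c + T d" if "c \<in> carrier_vec n" "d \<in> carrier_vec n" for c d
  proof -
    have "map_vec complex_of_real (c + d) = map_vec complex_of_real c + map_vec complex_of_real d"
      using that by auto
    then show ?thesis using A that by (simp add: T_def mult_add_distrib_mat_vec)
  qed
  have T_smult: "T (a \<cdot>\<^sub>v c) = complex_of_real a \<cdot>\<^sub>v T c" if "c \<in> carrier_vec n" for a c
  proof -
    have "map_vec complex_of_real (a \<cdot>\<^sub>v c) = complex_of_real a \<cdot>\<^sub>v map_vec complex_of_real c"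
      using that by auto
    then show ?thesis using A that by (simp add: T_def mult_mat_vec)
  qed
  have T_inj: "inj_on T (carrier_vec n)"
  proof (rule inj_onI)
    fix c d :: "real vec"
    assume c: "c \<in> carrier_vec n" and d: "d \<in> carrier_vec n" and eq: "T c = T d"
    have rec: "B *\<^sub>v T e = map_vec complex_of_real e" if "e \<in> carrier_vec n" for e
      using that A B BA by (simp add: T_def flip: assoc_mult_mat_vec)
    have "map_vec complex_of_real c = map_vec complex_of_real d"
      using rec[OF c] rec[OF d] eq by simp
    then show "c = d" using c d
      by (metis carrier_vecD eq_vecI index_map_vec(1) of_real_eq_iff)
  qed
  have T_zero: "T (0\<^sub>v n) = 0\<^sub>v n"
  proof -
    have "map_vec complex_of_real (0\<^sub>v n) = 0\<^sub>v n" by auto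
    moreover have "A *\<^sub>v 0\<^sub>v n = 0\<^sub>v n" using A by (intro eq_vecI) auto
    ultimately show ?thesis by (simp only: T_def)
  qed
  have diff: "T c - T d = T (c - d)" if "c \<in> carrier_vec n" "d \<in> carrier_vec n" for c d
  proof -
    have "T c = T (c - d) + T d"
    proof -
      have "c - d + d = c" using that by auto
      then show ?thesis using T_add[of "c - d" d] that by simp
    qed
    then show ?thesis using that T_car[of "c - d"] T_car[of d] by auto
  qed
  have carr: "carrier ?W = T ` carrier_vec n"
  proof (intro equalityI subsetI)
    fix w assume "w \<in> carrier ?W"
    then show "w \<in> T ` carrier_vec n"
      by (auto simp: cone_space_def K_def diff simp flip: T_def)
  next
    fix w assume "w \<in> T ` carrier_vec n"
    then obtain c where c: "c \<in> carrier_vec n" and w: "w = T c" by auto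
    let ?p = "vec n (\<lambda>i. max (c $ i) 0)" and ?q = "vec n (\<lambda>i. max (- (c $ i)) 0)"
    have "?p - ?q = c" using c by (auto simp: max_def)
    then have "w = T ?p - T ?q" using diff[of ?p ?q] w by simp
    moreover have "T ?p \<in> K" "T ?q \<in> K" unfolding K_def T_def by auto
    ultimately show "w \<in> carrier ?W" by (auto simp: cone_space_def)
  qed
  have W_simps: "add ?W = (+)" "zero ?W = 0\<^sub>v n" "smult ?W = (\<lambda>a v. complex_of_real a \<cdot>\<^sub>v v)"
    by (simp_all add: cone_space_def)
  have W_car: "carrier ?W \<subseteq> carrier_vec n" unfolding carr using T_car by auto
  have ab: "abelian_group ?W"
  proof (rule abelian_groupI, unfold W_simps)
    fix x y assume "x \<in> carrier ?W" "y \<in> carrier ?W"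
    then show "x + y \<in> carrier ?W" unfolding carr by (auto simp flip: T_add)
  next
    show "0\<^sub>v n \<in> carrier ?W" unfolding carr by (metis T_zero image_eqI zero_carrier_vec)
  next
    fix x assume "x \<in> carrier ?W"
    then obtain c where c: "c \<in> carrier_vec n" "x = T c" unfolding carr by auto
    then have "T (- c) + x = 0\<^sub>v n" using T_add[of "- c" c] T_zero by simp
    then show "\<exists>y\<in>carrier ?W. y + x = 0\<^sub>v n" unfolding carr using c by auto
  next
    fix x y assume "x \<in> carrier ?W" "y \<in> carrier ?W"
    then show "x + y = y + x" using W_car comm_add_vec[of x n y] by blast
  next
    fix x y z assume "x \<in> carrier ?W" "y \<in> carrier ?W" "z \<in> carrier ?W"
    then show "x + y + z = x + (y + z)" using W_car assoc_add_vec[of x n y z] by blast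
  qed (use W_car in auto)
  have "Module.module class_ring ?W"
  proof (rule Module.moduleI[OF class_cring.is_cring ab]; unfold W_simps class_ring_simps)
    fix a x assume "x \<in> carrier ?W"
    then show "complex_of_real a \<cdot>\<^sub>v x \<in> carrier ?W" unfolding carr by (auto simp flip: T_smult)
  next
    fix a x y assume "x \<in> carrier ?W" "y \<in> carrier ?W"
    then show "complex_of_real a \<cdot>\<^sub>v (x + y) = complex_of_real a \<cdot>\<^sub>v x + complex_of_real a \<cdot>\<^sub>v y"
      using W_car smult_add_distrib_vec[of x n y] by blast
  qed (auto simp: add_smult_distrib_vec smult_smult_assoc)
  then have W: "vectorspace class_ring ?W"
    using class_field unfolding vectorspace_def by blast
  have V: "vectorspace class_ring ?V" by (rule vec_vs)
  have hom: "T \<in> LinearCombinations.module_hom class_ring ?V ?W"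
    by (auto simp: LinearCombinations.module_hom_def carr W_simps module_vec_simps T_add T_smult)
  have "linear_map class_ring ?V ?W T"
    using V W hom unfolding linear_map_def mod_hom_def mod_hom_axioms_def vectorspace_def by auto
  then have "vectorspace.dim class_ring ?V = vectorspace.dim class_ring ?W"
    by (rule linear_map.dim_eq) (use T_inj carr vec_space.fin_dim in \<open>auto simp: module_vec_simps\<close>)
  then show ?thesis unfolding cone_dim_def K_def by (simp add: vec_space.dim_is_n)
qed

section \<open>The Fourier matrix and circulant matrices\<close>

lemma sum_powers_of_root_of_unity:
  assumes "1 \<le> n"
  shows "(\<Sum>k<n. cis (2 * pi * of_int m * real k / real n)) = (if int n dvd m then of_nat n else 0)"
proof -
  define z where "z = cis (2 * pi * of_int m / real n)"
  have "(\<Sum>k<n. cis (2 * pi * of_int m * real k / real n)) = (\<Sum>k<n. z ^ k)"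
    by (intro sum.cong refl) (simp add: z_def DeMoivre mult_ac)
  moreover have "z ^ n = 1"
    using assms by (simp add: z_def DeMoivre cis_multiple_2pi)
  moreover have "z = 1 \<longleftrightarrow> int n dvd m"
  proof
    assume "z = 1"
    then obtain l :: int where "2 * pi * of_int m / real n = 2 * pi * of_int l"
      unfolding z_def complex_eq_iff by (auto simp: cos_one_2pi_int)
    then have "real_of_int m = real_of_int (int n * l)" using assms by (simp add: field_simps)
    then show "int n dvd m" unfolding of_int_eq_iff by simp
  next
    assume "int n dvd m"
    then obtain l where "m = int n * l" by auto
    then have "2 * pi * of_int m / real n = 2 * pi * of_int l" using assms by simp
    then show "z = 1" using cis_multiple_2pi[of "of_int l"] by (simp only: Ints_of_int z_def)
  qed
  ultimately show ?thesis by (auto simp: geometric_sum)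
qed

definition inv_dft_mat :: "nat \<Rightarrow> complex mat" where
  "inv_dft_mat n = mat n n (\<lambda>(i, j). cis (2 * pi * real (i * j) / real n) / of_nat n)"

lemma dft_mat_carrier [simp]: "dft_mat n \<in> carrier_mat n n"
  by (simp add: dft_mat_def Let_def)

lemma dft_mat_dim [simp]: "dim_row (dft_mat n) = n" "dim_col (dft_mat n) = n"
  using dft_mat_carrier[of n] by (simp_all only: carrier_matD)

lemma inv_dft_mat_carrier [simp]: "inv_dft_mat n \<in> carrier_mat n n"
  by (simp add: inv_dft_mat_def)

lemma dft_mat_index:
  "i < n \<Longrightarrow> j < n \<Longrightarrow> dft_mat n $$ (i, j) = cis (- (2 * pi * real (i * j) / real n))"
proof -
  have "complex_of_real (cos t) - \<i> * complex_of_real (sin t) = cis (- t)" for t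
    by (simp add: complex_eq_iff)
  then show "i < n \<Longrightarrow> j < n \<Longrightarrow> ?thesis" by (simp add: dft_mat_def DeMoivre mult_ac)
qed

lemma dft_mat_transpose: "(dft_mat n)\<^sup>T = dft_mat n"
  by (auto simp: dft_mat_index mult.commute)

lemma dft_mat_inverse:
  assumes n: "1 \<le> n"
  shows "dft_mat n * inv_dft_mat n = 1\<^sub>m n" "inv_dft_mat n * dft_mat n = 1\<^sub>m n"
proof -
  show FG: "dft_mat n * inv_dft_mat n = 1\<^sub>m n"
  proof (rule eq_matI)
    fix i j assume "i < dim_row (1\<^sub>m n)" "j < dim_col (1\<^sub>m n)"
    then have i: "i < n" and j: "j < n" by auto
    have "(dft_mat n * inv_dft_mat n) $$ (i, j)
      = (\<Sum>k<n. cis (2 * pi * of_int (int j - int i) * real k / real n) / of_nat n)"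
    proof -
      have "cis (- (2 * pi * real (i * k) / real n)) * cis (2 * pi * real (k * j) / real n)
        = cis (2 * pi * of_int (int j - int i) * real k / real n)" for k
        by (simp add: cis_mult) (simp add: field_simps diff_divide_distrib)
      note e = this[symmetric]
      show ?thesis
        unfolding e using i j
        by (simp add: scalar_prod_def atLeast0LessThan dft_mat_index inv_dft_mat_def)
    qed
    also have "\<dots> = (if int n dvd int j - int i then 1 else 0)"
      using n by (simp add: sum_powers_of_root_of_unity del: of_int_diff flip: sum_divide_distrib)
    also have "\<dots> = 1\<^sub>m n $$ (i, j)"
    proof -
      have "int n dvd int j - int i \<longleftrightarrow> i = j"
        using i j by (simp flip: mod_eq_dvd_iff) auto
      then show ?thesis using i j by simp
    qed
    finally show "(dft_mat n * inv_dft_mat n) $$ (i, j) = 1\<^sub>m n $$ (i, j)" .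
  qed (simp_all add: inv_dft_mat_def)
  show "inv_dft_mat n * dft_mat n = 1\<^sub>m n"
    by (rule mat_mult_left_right_inverse[OF _ _ FG]) simp_all
qed

lemma inv_mat_dft_mat: "1 \<le> n \<Longrightarrow> inv_mat (dft_mat n) = inv_dft_mat n"
  by (rule inv_mat_eqI[of _ n]) (simp_all add: dft_mat_inverse)

text \<open>
  Expanding all products gives a double sum whose inner sum runs over the powers of the root of
  unity with exponent \<open>j - i - r\<close>; it vanishes unless \<open>r\<close> is congruent to \<open>j - i\<close>, which singles
  out one coordinate of \<open>a\<close>. The index is written \<open>n + j - i\<close> because subtraction of natural
  numbers truncates.
\<close>

lemma M_mat_dft_circulant:
  assumes n: "1 \<le> n" and a: "a \<in> carrier_vec n" and i: "i < n" and j: "j < n"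
  shows "M_mat (dft_mat n) (dft_mat n *\<^sub>v a) $$ (i, j) = a $ ((n + j - i) mod n)"
proof -
  define s where "s = (n + j - i) mod n"
  have s: "s < n" using n by (simp add: s_def)
  have dvd: "int n dvd int j - int i - int r \<longleftrightarrow> r = s" if "r < n" for r
  proof -
    have "int s = (int n + int j - int i) mod int n"
      using i by (simp add: s_def zmod_int of_nat_diff)
    then have "int s = (int j - int i) mod int n" by (metis add_diff_eq mod_add_self1)
    then have "int n dvd int j - int i - int r \<longleftrightarrow> int r mod int n = int s"
      by (metis mod_eq_dvd_iff)
    then show ?thesis using that by auto
  qed
  have "M_mat (dft_mat n) (dft_mat n *\<^sub>v a) $$ (i, j)
    = (\<Sum>k<n. \<Sum>r<n. a $ r * (cis (2 * pi * of_int (int j - int i - int r) * real k / real n) / of_nat n))"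
    unfolding M_mat_index[OF dft_mat_carrier inv_dft_mat_carrier[of n, folded inv_mat_dft_mat[OF n]] i j]
  proof (intro sum.cong refl)
    fix k assume "k \<in> {..<n}"
    then have k: "k < n" by simp
    have "cis (- (2 * pi * real (i * k) / real n)) * cis (- (2 * pi * real (k * r) / real n)) *
        cis (2 * pi * real (k * j) / real n)
      = cis (2 * pi * of_int (int j - int i - int r) * real k / real n)" for r
      by (simp add: cis_mult) (simp add: field_simps diff_divide_distrib add_divide_distrib)
    note e = this[symmetric]
    show "dft_mat n $$ (i, k) * (dft_mat n *\<^sub>v a) $ k * inv_mat (dft_mat n) $$ (k, j) =
      (\<Sum>r<n. a $ r * (cis (2 * pi * of_int (int j - int i - int r) * real k / real n) / of_nat n))"
      unfolding e using a i j k
      by (simp add: inv_mat_dft_mat[OF n] dft_mat_index inv_dft_mat_def scalar_prod_def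
        atLeast0LessThan sum_distrib_left sum_distrib_right mult_ac)
  qed
  also have "\<dots> = (\<Sum>r<n. a $ r * ((\<Sum>k<n. cis (2 * pi * of_int (int j - int i - int r) * real k / real n)) / of_nat n))"
    by (subst sum.swap) (simp add: sum_distrib_left sum_divide_distrib)
  also have "\<dots> = (\<Sum>r<n. if r = s then a $ r else 0)"
    using n by (intro sum.cong refl) (simp add: sum_powers_of_root_of_unity dvd del: of_int_diff)
  also have "\<dots> = a $ s" using s by simp
  finally show ?thesis unfolding s_def .
qed

lemma M_mat_dft_carrier: "1 \<le> n \<Longrightarrow> M_mat (dft_mat n) x \<in> carrier_mat n n"
  unfolding M_mat_def by (simp add: inv_mat_dft_mat mult_carrier_mat[of _ n n])

text \<open>The first row of the circulant matrix is \<open>a\<close>, and all its entries occur there.\<close>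

lemma nonneg_M_mat_dft_iff:
  assumes n: "1 \<le> n" and a: "a \<in> carrier_vec n"
  shows "nonneg_mat (M_mat (dft_mat n) (dft_mat n *\<^sub>v a)) \<longleftrightarrow> (\<forall>i<n. a $ i \<in> \<real>\<^sub>\<ge>\<^sub>0)"
proof
  assume L: "nonneg_mat (M_mat (dft_mat n) (dft_mat n *\<^sub>v a))"
  show "\<forall>i<n. a $ i \<in> \<real>\<^sub>\<ge>\<^sub>0"
  proof (intro allI impI)
    fix j assume j: "j < n"
    have "M_mat (dft_mat n) (dft_mat n *\<^sub>v a) $$ (0, j) = a $ j"
      using M_mat_dft_circulant[OF n a _ j, of 0] n j by simp
    moreover have "M_mat (dft_mat n) (dft_mat n *\<^sub>v a) $$ (0, j) \<in> \<real>\<^sub>\<ge>\<^sub>0"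
      using L M_mat_dft_carrier[OF n, of "dft_mat n *\<^sub>v a"] n j unfolding nonneg_mat_def by simp
    ultimately show "a $ j \<in> \<real>\<^sub>\<ge>\<^sub>0" by simp
  qed
next
  assume "\<forall>i<n. a $ i \<in> \<real>\<^sub>\<ge>\<^sub>0"
  then show "nonneg_mat (M_mat (dft_mat n) (dft_mat n *\<^sub>v a))"
    using M_mat_dft_carrier[OF n, of "dft_mat n *\<^sub>v a"] n
    unfolding nonneg_mat_def by (auto simp: M_mat_dft_circulant[OF n a])
qed

section \<open>The Fourier matrix is ideal and extremal\<close>

lemma spectracone_dft:
  assumes n: "1 \<le> n"
  shows "spectracone (dft_mat n)
    = {dft_mat n *\<^sub>v map_vec complex_of_real c | c. c \<in> carrier_vec n \<and> (\<forall>i<n. 0 \<le> c $ i)}"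
    (is "_ = ?R")
proof (intro equalityI subsetI)
  fix x assume x: "x \<in> spectracone (dft_mat n)"
  define a where "a = inv_dft_mat n *\<^sub>v x"
  have xn: "x \<in> carrier_vec n" using x by (simp add: spectracone_def)
  have a: "a \<in> carrier_vec n" using xn by (simp add: a_def mult_mat_vec_carrier[of _ n n])
  have xa: "x = dft_mat n *\<^sub>v a"
    using xn assoc_mult_mat_vec[OF dft_mat_carrier inv_dft_mat_carrier xn]
    by (simp add: a_def dft_mat_inverse[OF n])
  have an: "\<forall>i<n. a $ i \<in> \<real>\<^sub>\<ge>\<^sub>0"
    using x nonneg_M_mat_dft_iff[OF n a] unfolding xa spectracone_def by simp
  have "map_vec complex_of_real (map_vec Re a) = a"
    using a an by (auto simp: nonneg_Reals_def intro!: eq_vecI)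
  moreover have "\<forall>i<n. 0 \<le> map_vec Re a $ i"
    using a an by (auto simp: complex_nonneg_Reals_iff)
  ultimately show "x \<in> ?R" using xa a by (auto intro!: exI[of _ "map_vec Re a"])
next
  fix x assume "x \<in> ?R"
  then obtain c where c: "c \<in> carrier_vec n" "\<forall>i<n. 0 \<le> c $ i"
    and x: "x = dft_mat n *\<^sub>v map_vec complex_of_real c" by auto
  then show "x \<in> spectracone (dft_mat n)"
    using nonneg_M_mat_dft_iff[OF n, of "map_vec complex_of_real c"]
    by (simp add: spectracone_def mult_mat_vec_carrier[of _ n n])
qed

text \<open>
  The witness is the diagonal matrix conjugate to the all-ones matrix, whose irreducibility is
  immediate since it has no zero entries.
\<close>

lemma perron_similarity_dft:
  assumes n: "1 \<le> n"
  shows "perron_similarity (dft_mat n)"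
proof -
  let ?x = "dft_mat n *\<^sub>v ones_vec n"
  let ?D = "mat_diag n (\<lambda>i. ?x $ i)"
  have ones: "ones_vec n \<in> carrier_vec n" by (simp add: ones_vec_def)
  have M: "dft_mat n * ?D * inv_mat (dft_mat n) = M_mat (dft_mat n) ?x" by (simp add: M_mat_def)
  have "invertible_mat (dft_mat n)"
    unfolding invertible_mat_def inverts_mat_def
    using dft_mat_inverse[OF n] by (auto intro!: exI[of _ "inv_dft_mat n"] simp: inv_dft_mat_def)
  moreover have "diagonal_mat ?D" by (simp add: diagonal_mat_def mat_diag_def)
  moreover have "irreducible_mat (M_mat (dft_mat n) ?x)"
    using n by (intro irreducible_if_no_zero_entry[OF M_mat_dft_carrier[OF n]])
      (simp add: M_mat_dft_circulant[OF n ones], simp add: ones_vec_def)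
  moreover have "nonneg_mat (M_mat (dft_mat n) ?x)"
    unfolding nonneg_M_mat_dft_iff[OF n ones] by (simp add: ones_vec_def)
  ultimately show ?thesis
    unfolding perron_similarity_def by (intro conjI bexI[of _ ?D]) (simp_all add: M)
qed

text \<open>
  Row 1 of \<open>F\<close>, counting from 0, which lists the \<open>n\<close>-th roots of unity, is the spectrum of the cyclic
  permutation matrix and has modulus 1 in every coordinate.
\<close>

lemma extremal_perron_dft:
  assumes n: "2 \<le> n"
  shows "extremal_perron (dft_mat n)"
proof -
  have n1: "1 \<le> n" using n by simp
  define x where "x = dft_mat n *\<^sub>v unit_vec n 1"
  have u: "unit_vec n 1 \<in> carrier_vec n" by simp
  have xk: "x $ k = cis (- (2 * pi * real k / real n))" if "k < n" for k
    using that n by (simp add: x_def dft_mat_index)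
  have xn: "x \<in> carrier_vec n" by (simp add: x_def mult_mat_vec_carrier[of _ n n])
  have "nonneg_mat (M_mat (dft_mat n) x)"
    unfolding x_def nonneg_M_mat_dft_iff[OF n1 u] by (simp add: unit_vec_def)
  moreover have "M_mat (dft_mat n) x *\<^sub>v ones_vec n = ones_vec n"
  proof (rule eq_vecI)
    fix i assume "i < dim_vec (ones_vec n)"
    then have i: "i < n" by (simp add: ones_vec_def)
    have "(M_mat (dft_mat n) x *\<^sub>v ones_vec n) $ i = (\<Sum>j<n. M_mat (dft_mat n) x $$ (i, j))"
      using M_mat_dft_carrier[OF n1, of x] i by (simp add: scalar_prod_def ones_vec_def atLeast0LessThan)
    also have "\<dots> = (\<Sum>j<n. if j = (i + 1) mod n then 1 else 0)"
    proof (intro sum.cong refl)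
      fix j assume "j \<in> {..<n}"
      then have j: "j < n" by simp
      have "(n + j - i) mod n = 1 \<longleftrightarrow> j = (i + 1) mod n"
        using i j n by (auto simp: mod_if)
      then show "M_mat (dft_mat n) x $$ (i, j) = (if j = (i + 1) mod n then 1 else 0)"
        unfolding x_def M_mat_dft_circulant[OF n1 u i j] using n by simp
    qed
    also have "\<dots> = 1" using n by simp
    finally show "(M_mat (dft_mat n) x *\<^sub>v ones_vec n) $ i = ones_vec n $ i"
      using i by (simp add: ones_vec_def)
  qed (use M_mat_dft_carrier[OF n1, of x] in \<open>simp add: ones_vec_def\<close>)
  ultimately have P: "x \<in> spectratope (dft_mat n)"
    using xn by (simp add: spectratope_def spectracone_def)
  have "x \<in> SL1 n"
    using spectratope_imp_SL1[OF dft_mat_carrier inv_dft_mat_carrier dft_mat_inverse[OF n1] P] xk[of 0] n by simp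
  then have "extremal_point n x"
    using n by (intro extremal_pointI[of _ _ 1]) (simp_all add: xk)
  moreover have "x \<noteq> ones_vec n"
  proof
    \<comment> \<open>The roots of unity sum to 0, the coordinates of \<open>e\<close> to \<open>n\<close>.\<close>
    assume "x = ones_vec n"
    then have "(\<Sum>k<n. x $ k) = of_nat n" by (simp add: ones_vec_def)
    moreover have "(\<Sum>k<n. x $ k) = (\<Sum>k<n. cis (2 * pi * of_int (- 1) * real k / real n))"
      by (intro sum.cong refl) (simp add: xk)
    ultimately show False using n by (simp add: sum_powers_of_root_of_unity[OF n1, of "- 1"] del: of_int_minus)
  qed
  ultimately show ?thesis
    unfolding extremal_perron_def using P perron_similarity_dft[OF n1] by auto
qed

theorem corollary7p1:
  fixes n :: nat
  assumes "1 \<le> n"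
  shows "ideal_perron (dft_mat n) \<and>
    (2 \<le> n \<longrightarrow> extremal_perron (dft_mat n)) \<and>
    cone_dim n (spectracone (dft_mat n)) = n"
proof (intro conjI impI)
  have F: "dft_mat n \<in> carrier_mat n n" by simp
  show "ideal_perron (dft_mat n)"
    unfolding ideal_perron_def spectracone_dft[OF assms] row_cone_eq[OF F] dft_mat_transpose
    using perron_similarity_dft[OF assms] by simp
  show "extremal_perron (dft_mat n)" if "2 \<le> n" using that by (rule extremal_perron_dft)
  show "cone_dim n (spectracone (dft_mat n)) = n"
    unfolding spectracone_dft[OF assms]
    by (rule cone_dim_simplicial[OF F inv_dft_mat_carrier dft_mat_inverse(2)[OF assms]])
qed

end
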